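(* Let $L$ be a solvable Lie algebra with abelian nilradical $N$ such that the dimension of the complementary space to the nilradical is equal to one. Then any local derivation on $L$ is a derivation if and only if $ad_x$ is a diagonalizable operator.
   Context: The nilradical of a Lie algebra is its unique maximal nilpotent ideal. Here $\dim N = n$, $\dim L = n+1$, and $\{x, e_1, e_2, \dots, e_n\}$ is a basis of $L$ such that $\{e_1, e_2, \dots, e_n\}$ is a basis of $N$; thus $x$ spans a complementary space to $N$. The operator $ad_x$ is the operator of right multiplication by $x$, $ad_x(z) = [z,x]$, considered on $N$. A derivation on $L$ is a linear map $d : L \to L$ with $d([u,v]) = [d(u),v] + [u,d(v)]$ for all $u,v \in L$. A linear operator $\Delta : L \to L$ is called a local derivation if for every $u \in L$ there exists a derivation $d_u : L \to L$ (depending on $u$) such that $\Delta(u) = d_u(u)$. *)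

theory Defs
  imports Complex_Main
begin

text \<open>
  A Lie algebra over an arbitrary field, carried by the whole type \<open>'v\<close>. No dimension is
  fixed here. Alternation is required in the form \<open>[u,u] = 0\<close>, which is the correct axiom in
  every characteristic.
\<close>

locale lie_algebra = vector_space scale
  for scale :: "'k::field \<Rightarrow> 'v::ab_group_add \<Rightarrow> 'v" +
  fixes bracket :: "'v \<Rightarrow> 'v \<Rightarrow> 'v"
  assumes linear_left: "Vector_Spaces.linear scale scale (\<lambda>u. bracket u v)"
    and linear_right: "Vector_Spaces.linear scale scale (\<lambda>v. bracket u v)"
    and alternating: "bracket u u = 0"
    and jacobi: "bracket u (bracket v w) + bracket v (bracket w u) + bracket w (bracket u v) = 0"
begin

definition basis_of :: "'v set \<Rightarrow> 'v set \<Rightarrow> bool" where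
  "basis_of B V \<longleftrightarrow> independent B \<and> span B = V"

definition bracket_space :: "'v set \<Rightarrow> 'v set \<Rightarrow> 'v set" where
  "bracket_space U V = span {bracket u v | u v. u \<in> U \<and> v \<in> V}"

primrec derived_series :: "'v set \<Rightarrow> nat \<Rightarrow> 'v set" where
  "derived_series I 0 = I"
| "derived_series I (Suc k) = bracket_space (derived_series I k) (derived_series I k)"

primrec lower_central_series :: "'v set \<Rightarrow> nat \<Rightarrow> 'v set" where
  "lower_central_series I 0 = I"
| "lower_central_series I (Suc k) = bracket_space (lower_central_series I k) I"

definition solvable :: "'v set \<Rightarrow> bool" where
  "solvable I \<longleftrightarrow> (\<exists>k. derived_series I k = {0})"

definition nilpotent :: "'v set \<Rightarrow> bool" where
  "nilpotent I \<longleftrightarrow> (\<exists>k. lower_central_series I k = {0})"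

definition abelian :: "'v set \<Rightarrow> bool" where
  "abelian I \<longleftrightarrow> (\<forall>u\<in>I. \<forall>v\<in>I. bracket u v = 0)"

definition lie_ideal :: "'v set \<Rightarrow> bool" where
  "lie_ideal I \<longleftrightarrow> subspace I \<and> (\<forall>u\<in>I. \<forall>v. bracket u v \<in> I)"

definition maximal_nilpotent_ideal :: "'v set \<Rightarrow> bool" where
  "maximal_nilpotent_ideal I \<longleftrightarrow> lie_ideal I \<and> nilpotent I \<and>
     (\<forall>J. lie_ideal J \<and> nilpotent J \<and> I \<subseteq> J \<longrightarrow> J = I)"

definition is_nilradical :: "'v set \<Rightarrow> bool" where
  "is_nilradical N \<longleftrightarrow> maximal_nilpotent_ideal N \<and> (\<forall>M. maximal_nilpotent_ideal M \<longrightarrow> M = N)"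

definition ad :: "'v \<Rightarrow> 'v \<Rightarrow> 'v" where
  "ad x z = bracket z x"

text \<open>
  \<open>diagonalizable_on V T\<close> says that \<open>T\<close>, considered as an operator on the subspace \<open>V\<close>, is
  diagonalizable over the ground field; the condition forces \<open>V\<close> to be invariant under a
  linear \<open>T\<close>.
\<close>

definition diagonalizable_on :: "'v set \<Rightarrow> ('v \<Rightarrow> 'v) \<Rightarrow> bool" where
  "diagonalizable_on V T \<longleftrightarrow> (\<exists>B. basis_of B V \<and> (\<forall>b\<in>B. \<exists>c. T b = scale c b))"

definition derivation :: "('v \<Rightarrow> 'v) \<Rightarrow> bool" where
  "derivation d \<longleftrightarrow> Vector_Spaces.linear scale scale d \<and>
     (\<forall>u v. d (bracket u v) = bracket (d u) v + bracket u (d v))"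

definition local_derivation :: "('v \<Rightarrow> 'v) \<Rightarrow> bool" where
  "local_derivation \<Delta> \<longleftrightarrow> Vector_Spaces.linear scale scale \<Delta> \<and>
     (\<forall>u. \<exists>d. derivation d \<and> \<Delta> u = d u)"

end

end

theory Submission
  imports Defs "HOL-Computational_Algebra.Polynomial"
begin

text \<open>
  Write \<open>T\<close> for \<open>ad x\<close> on \<open>N\<close>. As \<open>N\<close> is abelian of codimension one, the bracket is determined by \<open>T\<close>,
  so derivations can be read off from linear algebra. A linear map \<open>D\<close> on \<open>L\<close> with image in \<open>N\<close> is a
  derivation as soon as it commutes with \<open>T\<close> on \<open>N\<close>, whatever its value at \<open>x\<close>
  (\<open>derivation_if_commutes\<close>). Moreover \<open>T \<noteq> 0\<close>, since otherwise \<open>L\<close> would be abelian and hence equal to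
  its nilradical.

  If \<open>T\<close> is diagonalizable, every derivation has this form (\<open>derivation_commutes\<close>): an eigenvector
  with nonzero eigenvalue forces \<open>d\<close> to map \<open>N\<close> into \<open>N\<close>; writing \<open>d x = a x + z\<close> with \<open>z\<close> in \<open>N\<close>, the
  derivation rule then reads \<open>d T - T d = a T\<close> on \<open>N\<close>, and comparing coefficients of that eigenvector
  gives \<open>a = 0\<close> in every characteristic. Hence a local derivation also maps \<open>L\<close> into \<open>N\<close> and preserves
  every eigenspace of \<open>T\<close>, so it commutes with \<open>T\<close> on \<open>N\<close> and is a derivation.

  If \<open>T\<close> is not diagonalizable, the task is to find a linear \<open>D\<close> on \<open>N\<close> that agrees at each vector with
  some operator commuting with \<open>T\<close> but does not itself commute with \<open>T\<close>
  (\<open>diagonalizable_or_locally_commuting\<close>). Extended by zero at \<open>x\<close>, this \<open>D\<close> is a local derivation: off \<open>N\<close> the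
  freedom in the value at \<open>x\<close> settles the matter. The minimal polynomial \<open>\<mu>\<close> of \<open>T\<close> has the form \<open>P \<sigma>\<close>
  where \<open>P\<close> is either irreducible of degree at least two or the square of a linear polynomial. In both
  cases \<open>k[t]/(P)\<close> has a smallest nonzero ideal, generated by some \<open>\<rho>\<close> (\<open>socle_generator\<close>). With
  \<open>w = \<rho>(T) c \<noteq> 0\<close> for some \<open>c\<close> in the image of \<open>\<sigma>(T)\<close>, every nonzero vector of that image can be sent to \<open>w\<close> by an
  operator commuting with \<open>T\<close> on the kernel of \<open>P(T)\<close> (\<open>commuting_map_exists\<close>). So each rank-one
  operator \<open>D u = f(\<sigma>(T) u) w\<close> is locally a commuting one, and a suitable functional \<open>f\<close> makes it fail
  to commute with \<open>T\<close>.
\<close>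

section \<open>Quotients of the polynomial ring with a smallest nonzero ideal\<close>

lemma irreducible_factor_exists:
  fixes p :: "'k::field poly"
  assumes "degree p > 0"
  obtains q where "irreducible q" "q dvd p"
proof -
  define Q where "Q q \<longleftrightarrow> q dvd p \<and> degree q > 0" for q
  have "Q p" using assms by (simp add: Q_def)
  then obtain q where q: "Q q" and min: "\<And>r. Q r \<Longrightarrow> degree q \<le> degree r"
    by (metis ex_has_least_nat)
  have "q \<noteq> 0" using q by (auto simp: Q_def)
  have "irreducible q"
  proof (rule irreducibleI)
    show "q \<noteq> 0" by fact
    show "\<not> is_unit q"
      using q is_unit_iff_degree[OF \<open>q \<noteq> 0\<close>] by (simp add: Q_def)
    fix a b assume ab: "q = a * b"
    then have nz: "a \<noteq> 0" "b \<noteq> 0" using \<open>q \<noteq> 0\<close> by auto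
    have "q dvd p" using q by (simp add: Q_def)
    then have dvd: "a dvd p" "b dvd p" using ab dvd_mult_left dvd_mult_right by blast+
    have deg: "degree q = degree a + degree b" using ab nz by (simp add: degree_mult_eq)
    show "a dvd 1 \<or> b dvd 1"
    proof (rule ccontr)
      assume "\<not> ?thesis"
      then have "degree a > 0" "degree b > 0"
        using is_unit_iff_degree[OF nz(1)] is_unit_iff_degree[OF nz(2)] by auto
      then show False using min[of a] dvd deg by (auto simp: Q_def)
    qed
  qed
  then show ?thesis using q that by (auto simp: Q_def)
qed

text \<open>
  The class of \<open>\<rho>\<close> is nonzero in \<open>k[t]/(P)\<close> and is a multiple of every nonzero class, that is, it
  generates the simple socle of this ring.
\<close>

definition socle_generator :: "'k::field poly \<Rightarrow> 'k poly \<Rightarrow> bool" where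
  "socle_generator P \<rho> \<longleftrightarrow> \<rho> \<noteq> 0 \<and> degree \<rho> < degree P \<and>
     (\<forall>h. h \<noteq> 0 \<and> degree h < degree P \<longrightarrow> (\<exists>r s. r * h + s * P = \<rho>))"

text \<open>
  Here \<open>k[t]/(P)\<close> is a field. The coefficients come from an element of least degree in the ideal
  generated by \<open>h\<close> and \<open>P\<close>, which divides both.
\<close>

lemma socle_generator_irreducible:
  fixes P :: "'k::field poly"
  assumes irr: "irreducible P"
  shows "socle_generator P 1"
proof -
  have P0: "P \<noteq> 0" "\<not> is_unit P" using irr by (auto simp: irreducible_def)
  then have deg: "degree P > 0" using is_unit_iff_degree[of P] by simp
  have "\<exists>r s. r * h + s * P = 1" if h: "h \<noteq> 0" "degree h < degree P" for h
  proof -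
    define J where "J q \<longleftrightarrow> q \<noteq> 0 \<and> (\<exists>r s. q = r * h + s * P)" for q
    have "h = 1 * h + 0 * P" by simp
    then have "J h" using h unfolding J_def by blast
    then obtain q where q: "J q" and min: "\<And>r. J r \<Longrightarrow> degree q \<le> degree r"
      by (metis ex_has_least_nat)
    obtain r s where rs: "q = r * h + s * P" and q0: "q \<noteq> 0" using q by (auto simp: J_def)
    have dvd: "q dvd m" if m: "m = a * h + b * P" for m a b
    proof (rule ccontr)
      assume "\<not> q dvd m"
      then have nz: "m mod q \<noteq> 0" by (simp add: dvd_eq_mod_eq_0)
      have "m mod q = m - (m div q) * q" by (simp add: minus_div_mult_eq_mod)
      also have "\<dots> = (a * h + b * P) - (m div q) * (r * h + s * P)"
        using m rs by metis
      also have "\<dots> = (a - (m div q) * r) * h + (b - (m div q) * s) * P"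
        by (simp add: algebra_simps)
      finally have "J (m mod q)" using nz unfolding J_def by blast
      then show False using min[of "m mod q"] degree_mod_less[OF q0, of m] nz by auto
    qed
    have "q dvd h" using dvd[of h 1 0] by simp
    have "q dvd P" using dvd[of P 0 1] by simp
    then obtain m where m: "P = q * m" by (auto simp: dvd_def)
    have "\<not> is_unit m"
    proof
      assume "is_unit m"
      then have "P dvd q" using m by simp
      then have "P dvd h" using \<open>q dvd h\<close> dvd_trans by blast
      then show False using h dvd_imp_degree_le[of P h] by auto
    qed
    then have "is_unit q" using irreducibleD[OF irr m] by auto
    then obtain t where t: "1 = q * t" by (auto simp: dvd_def)
    have "(t * r) * h + (t * s) * P = 1" using t rs by (simp add: algebra_simps)
    then show ?thesis by blast
  qed
  then show ?thesis using deg by (auto simp: socle_generator_def)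
qed

text \<open>
  In \<open>k[t]/(t - a)\<^sup>2\<close> a nonzero \<open>h\<close> with root \<open>a\<close> is a constant multiple of \<open>t - a\<close>. Any other \<open>h\<close> is a
  nonzero constant modulo \<open>t - a\<close>, so \<open>(t - a) h\<close> is a nonzero multiple of \<open>t - a\<close>.
\<close>

lemma socle_generator_square:
  fixes a :: "'k::field"
  shows "socle_generator ([:- a, 1:]\<^sup>2) [:- a, 1:]"
proof -
  let ?l = "[:- a, 1:]"
  have d2: "degree (?l\<^sup>2) = 2" by (simp add: degree_power_eq)
  have "\<exists>r s. r * h + s * ?l\<^sup>2 = ?l" if h: "h \<noteq> 0" "degree h < 2" for h :: "'k poly"
  proof (cases "poly h a = 0")
    case True
    then obtain k where k: "h = ?l * k" using poly_eq_0_iff_dvd[of h a] by (auto simp: dvd_def)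
    have k0: "k \<noteq> 0" using h k by auto
    then have "degree h = 1 + degree k" unfolding k by (subst degree_mult_eq) auto
    then have "degree k = 0" using h by simp
    then obtain b where b: "k = [:b:]" by (rule degree_eq_zeroE)
    then have "b \<noteq> 0" using k0 by simp
    have "[:inverse b:] * h + 0 * ?l\<^sup>2 = ?l * ([:inverse b:] * [:b:])"
      unfolding k b by (simp only: mult_zero_left add_0_right mult_ac)
    also have "[:inverse b:] * [:b:] = 1" using \<open>b \<noteq> 0\<close> by (simp add: one_pCons)
    finally have "[:inverse b:] * h + 0 * ?l\<^sup>2 = ?l" by simp
    then show ?thesis by blast
  next
    case False
    have "poly (h - [:poly h a:]) a = 0" by simp
    then obtain k where k: "h - [:poly h a:] = ?l * k"
      using poly_eq_0_iff_dvd[of "h - [:poly h a:]" a] by (auto simp: dvd_def)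
    let ?c = "inverse (poly h a)"
    have h': "h = [:poly h a:] + ?l * k" using k by (simp add: algebra_simps)
    have u: "[:?c:] * [:poly h a:] = 1" using False by (simp add: one_pCons)
    have "(c * l) * (b + l * k) + (- (c * k)) * l\<^sup>2 = l * (c * b)" for b c l :: "'k poly"
      by (simp add: algebra_simps power2_eq_square)
    from this[of "[:?c:]" ?l "[:poly h a:]"] have "([:?c:] * ?l) * h + (- ([:?c:] * k)) * ?l\<^sup>2 = ?l"
      unfolding u using h' by simp
    then show ?thesis by blast
  qed
  then show ?thesis unfolding socle_generator_def d2 by auto
qed

section \<open>Polynomials acting through a linear operator\<close>

locale operator_action = vector_space scale
  for scale :: "'k::field \<Rightarrow> 'v::ab_group_add \<Rightarrow> 'v" +
  fixes T :: "'v \<Rightarrow> 'v"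
  assumes linear_T: "Vector_Spaces.linear scale scale T"
begin

lemma T_add: "T (u + v) = T u + T v" and T_scale: "T (scale c v) = scale c (T v)"
  using linear_T by (auto simp: Vector_Spaces.linear_iff)

lemma T_0 [simp]: "T 0 = 0" using T_scale[of 0 0] by simp

definition act :: "'k poly \<Rightarrow> 'v \<Rightarrow> 'v" where
  "act p v = (\<Sum>i\<le>degree p. scale (coeff p i) ((T ^^ i) v))"

lemma act_upto:
  assumes "degree p \<le> n"
  shows "act p v = (\<Sum>i\<le>n. scale (coeff p i) ((T ^^ i) v))"
  unfolding act_def using assms
  by (intro sum.mono_neutral_left) (auto simp: coeff_eq_0)

lemma act_0 [simp]: "act 0 v = 0" by (simp add: act_def)

lemma act_pCons [simp]: "act (pCons a p) v = scale a v + T (act p v)"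
proof -
  have sum_T: "T (sum f A) = (\<Sum>i\<in>A. T (f i))" for f and A :: "nat set"
    by (induction A rule: infinite_finite_induct) (simp_all add: T_add)
  have "act (pCons a p) v = (\<Sum>i\<le>Suc (degree p). scale (coeff (pCons a p) i) ((T ^^ i) v))"
    by (rule act_upto) (simp add: degree_pCons_le)
  also have "\<dots> = scale a v + T (act p v)"
    unfolding act_def sum_T sum.atMost_Suc_shift by (simp add: T_scale)
  finally show ?thesis .
qed

lemma act_1 [simp]: "act 1 v = v" by (simp add: one_pCons)

lemma act_add: "act (p + q) v = act p v + act q v"
  by (induction p q rule: poly_induct2) (simp_all add: T_add scale_left_distrib algebra_simps)

lemma act_smult: "act (smult c p) v = scale c (act p v)"
  by (induction p) (simp_all add: T_scale scale_right_distrib)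

lemma act_mult: "act (p * q) v = act p (act q v)"
  by (induction p) (simp_all add: act_add act_smult)

lemma act_diff: "act (p - q) v = act p v - act q v"
  using act_add[of "p - q" q v] by (simp add: algebra_simps)

lemma act_add_right: "act p (u + v) = act p u + act p v"
  by (induction p) (simp_all add: T_add scale_right_distrib algebra_simps)

lemma act_scale_right: "act p (scale c v) = scale c (act p v)"
  by (induction p) (simp_all add: T_scale scale_right_distrib mult.commute)

lemma act_0_right [simp]: "act p 0 = 0"
  using act_scale_right[of p 0 0] by simp

lemma act_diff_right: "act p (u - v) = act p u - act p v"
  using act_add_right[of p "u - v" v] by (simp add: algebra_simps)

lemma act_T: "act p (T v) = T (act p v)"
  by (induction p) (simp_all add: T_add T_scale)

lemma act_eigenvector: "T v = scale c v \<Longrightarrow> act p v = scale (poly p c) v"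
  by (induction p) (simp_all add: T_add T_scale scale_left_distrib mult.commute)

lemma act_closed:
  assumes "subspace M" "\<And>u. u \<in> M \<Longrightarrow> T u \<in> M" "v \<in> M"
  shows "act p v \<in> M"
  by (induction p) (use assms in \<open>auto intro: subspace_add subspace_scale subspace_0\<close>)

text \<open>
  Each coefficient in \<open>t\<close> of the divided difference \<open>(P(t) - P(s)) / (t - s)\<close> is a polynomial in \<open>s\<close>;
  letting it act on \<open>v\<close> with \<open>s = T\<close> and applying \<open>g\<close> gives the corresponding coefficient of \<open>H v\<close>.
  Multiplying by \<open>t - s\<close> yields the last equation. On the kernel of \<open>P(T)\<close> it says that multiplication by \<open>t\<close> and application of \<open>T\<close> agree modulo
  \<open>P\<close>, so that \<open>H\<close> turns a plain linear functional into a \<open>k[t]\<close>-linear map to \<open>k[t]/(P)\<close>.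
  The recursion on \<open>P = a + t Q\<close> is that of Horner's scheme.
\<close>

lemma divided_difference:
  assumes g: "Vector_Spaces.linear scale (*) g"
  obtains H where
    "\<And>u v. H (u + v) = H u + H v" "\<And>c v. H (scale c v) = smult c (H v)"
    "\<And>v i. i \<ge> degree P \<Longrightarrow> coeff (H v) i = 0"
    "\<And>v. pCons 0 (H v) - H (T v) = smult (g v) P - [:g (act P v):]"
proof -
  have g_add: "g (u + v) = g u + g v" and g_scale: "g (scale c v) = c * g v" for u v c
    using g by (auto simp: Vector_Spaces.linear_iff)
  have "\<exists>H. (\<forall>u v. H (u + v) = H u + H v) \<and> (\<forall>c v. H (scale c v) = smult c (H v)) \<and>
     (\<forall>v i. i \<ge> degree P \<longrightarrow> coeff (H v) i = 0) \<and>
     (\<forall>v. pCons 0 (H v) - H (T v) = smult (g v) P - [:g (act P v):])"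
  proof (induction P rule: pCons_induct)
    case 0
    then show ?case using g_scale[of 0 0] by (intro exI[of _ "\<lambda>_. 0"]) simp
  next
    case (pCons a Q)
    then obtain H where H: "\<And>u v. H (u + v) = H u + H v" "\<And>c v. H (scale c v) = smult c (H v)"
      "\<And>v i. i \<ge> degree Q \<Longrightarrow> coeff (H v) i = 0"
      "\<And>v. pCons 0 (H v) - H (T v) = smult (g v) Q - [:g (act Q v):]" by blast
    let ?H = "\<lambda>v. pCons (g (act Q v)) (H v)"
    show ?case
    proof (intro exI[of _ ?H] conjI allI impI)
      show "?H (u + v) = ?H u + ?H v" for u v by (simp add: H act_add_right g_add)
      show "?H (scale c v) = smult c (?H v)" for c v by (simp add: H act_scale_right g_scale)
      fix v i assume i: "degree (pCons a Q) \<le> i"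
      show "coeff (?H v) i = 0"
      proof (cases "Q = 0")
        case True
        then have "H v = 0" using H(3)[of _ v] by (intro poly_eqI) simp
        then show ?thesis using True g_scale[of 0 0] by simp
      next
        case False
        then obtain j where "i = Suc j" "j \<ge> degree Q" using i by (cases i) auto
        then show ?thesis by (simp add: H)
      qed
    next
      fix v
      have "pCons 0 (?H v) - ?H (T v) = pCons (- g (act Q (T v))) (?H v - H (T v))" by simp
      also have "?H v = [:g (act Q v):] + pCons 0 (H v)" by simp
      also have "[:g (act Q v):] + pCons 0 (H v) - H (T v) = smult (g v) Q"
        using H(4)[of v] by (simp add: algebra_simps)
      finally show "pCons 0 (?H v) - ?H (T v)
          = smult (g v) (pCons a Q) - [:g (act (pCons a Q) v):]"
        by (simp add: g_add g_scale act_T)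
    qed
  qed
  then show ?thesis using that by blast
qed

lemma functional_exists:
  assumes "v \<noteq> 0"
  obtains f where "Vector_Spaces.linear scale (*) f" "f v = 1"
proof -
  have ind: "independent {v}" using assms by simp
  let ?E = "extend_basis {v}"
  have E: "independent ?E" "span ?E = UNIV" "{v} \<subseteq> ?E"
    using independent_extend_basis[OF ind] span_extend_basis[OF ind] extend_basis_superset[OF ind]
    by blast+
  show ?thesis
  proof (rule that[of "\<lambda>u. representation ?E u v"])
    show "Vector_Spaces.linear scale (*) (\<lambda>u. representation ?E u v)"
      using linear_representation[OF E(1,2)] by simp
    show "representation ?E v v = 1" using E by (simp add: representation_basis)
  qed
qed

text \<open>
  This is the self-injectivity of \<open>k[t]/(P)\<close> made explicit. A functional \<open>g\<close> with \<open>g e = 1\<close> gives, through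
  its divided difference \<open>H\<close>, the \<open>k[t]\<close>-linear map \<open>v \<mapsto> H v\<close> from the kernel of \<open>P(T)\<close> to \<open>k[t]/(P)\<close>, which does
  not vanish at \<open>e\<close>. A multiple of it sends \<open>e\<close> to the socle generator, and evaluation at \<open>c\<close> brings the
  values back into the vector space.
\<close>

lemma commuting_map_exists:
  assumes soc: "socle_generator P \<rho>" and e: "act P e = 0" "e \<noteq> 0" and c: "act P c = 0"
  obtains A where "Vector_Spaces.linear scale scale A" "A e = act \<rho> c"
    "\<And>v. act P v = 0 \<Longrightarrow> A (T v) = T (A v)" "\<And>v. \<exists>q. A v = act q c"
proof -
  obtain g where g: "Vector_Spaces.linear scale (*) g" "g e = 1"
    using functional_exists[OF e(2)] .
  obtain H where H: "\<And>u v. H (u + v) = H u + H v" "\<And>c v. H (scale c v) = smult c (H v)"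
    "\<And>v i. i \<ge> degree P \<Longrightarrow> coeff (H v) i = 0"
    "\<And>v. pCons 0 (H v) - H (T v) = smult (g v) P - [:g (act P v):]"
    using divided_difference[OF g(1), of P] by blast
  have g0: "g 0 = 0" using g(1) by (metis Vector_Spaces.linear_iff mult_zero_left scale_zero_left)
  have degP: "degree P > 0" using soc by (auto simp: socle_generator_def)
  have key: "pCons 0 (H v) = H (T v) + smult (g v) P" if "act P v = 0" for v
    using H(4)[of v] that by (simp add: g0 algebra_simps)
  \<comment> \<open>The leading coefficient of \<open>P\<close> reappears in \<open>H e\<close>, one degree lower, with the factor \<open>g e = 1\<close>.\<close>
  have "H e \<noteq> 0"
  proof
    assume "H e = 0"
    then have "coeff (H (T e) + smult (g e) P) (degree P) = 0" using key[OF e(1)] by (metis coeff_0 pCons_0_0)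
    then show False using H(3)[of "degree P" "T e"] g(2) degP by auto
  qed
  moreover have "degree (H e) < degree P"
    using H(3)[of _ e] degP \<open>H e \<noteq> 0\<close> by (metis leading_coeff_0_iff not_le)
  ultimately obtain r s where rs: "r * H e + s * P = \<rho>"
    using soc unfolding socle_generator_def by blast
  show ?thesis
  proof (rule that[of "\<lambda>v. act r (act (H v) c)"])
    show "Vector_Spaces.linear scale scale (\<lambda>v. act r (act (H v) c))"
      by (simp add: Vector_Spaces.linear_iff vector_space_axioms H act_add act_smult act_add_right act_scale_right)
    show "act r (act (H e) c) = act \<rho> c"
      unfolding rs[symmetric] by (simp add: act_add act_mult c)
    show "act r (act (H (T v)) c) = T (act r (act (H v) c))" if "act P v = 0" for v
    proof -
      have "T (act (H v) c) = act (pCons 0 (H v)) c" by simp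
      also have "\<dots> = act (H (T v)) c" unfolding key[OF that] by (simp add: act_add act_smult c)
      finally show ?thesis by (simp flip: act_T)
    qed
    show "\<exists>q. act r (act (H v) c) = act q c" for v by (metis act_mult)
  qed
qed

section \<open>Operators that commute only locally\<close>

text \<open>
  Membership in the reflexive closure of the commutant of \<open>T\<close> on \<open>N\<close>: the commuting operator may depend
  on the vector.
\<close>

definition locally_commuting :: "'v set \<Rightarrow> ('v \<Rightarrow> 'v) \<Rightarrow> bool" where
  "locally_commuting N D \<longleftrightarrow> (\<forall>u\<in>N. \<exists>A. Vector_Spaces.linear scale scale A \<and> range A \<subseteq> N \<and>
     (\<forall>v\<in>N. A (T v) = T (A v)) \<and> D u = A u)"

text \<open>
  The operator is \<open>D v = f(\<sigma>(T) v) w\<close> with \<open>w = \<rho>(T) \<sigma>(T) v0\<close>. All vectors \<open>\<sigma>(T) v\<close> lie in the kernel of \<open>P(T)\<close>, so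
  any nonzero one can be moved to \<open>w\<close> by a map that commutes with \<open>T\<close>; this makes every such \<open>D\<close>
  locally commuting. The last hypothesis says that \<open>T\<close> is not scalar on the image of \<open>\<sigma>(T)\<close>, and it
  is what leaves room for an \<open>f\<close> violating \<open>D T = T D\<close>.
\<close>

lemma locally_commuting_not_commuting:
  assumes N: "subspace N" "\<And>u. u \<in> N \<Longrightarrow> T u \<in> N"
    and soc: "socle_generator P \<rho>"
    and ann: "\<And>v. v \<in> N \<Longrightarrow> act (P * \<sigma>) v = 0"
    and nz: "\<exists>v\<in>N. act (\<rho> * \<sigma>) v \<noteq> 0"
    and nonscalar: "\<And>a. \<exists>v\<in>N. act ([:- a, 1:] * \<sigma>) v \<noteq> 0"
  obtains D where "Vector_Spaces.linear scale scale D" "range D \<subseteq> N"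
    "locally_commuting N D" "\<exists>u\<in>N. D (T u) \<noteq> T (D u)"
proof -
  obtain v0 where v0: "v0 \<in> N" "act (\<rho> * \<sigma>) v0 \<noteq> 0" using nz by blast
  define c where "c = act \<sigma> v0"
  define w where "w = act \<rho> c"
  have closed: "act p v \<in> N" if "v \<in> N" for p v using act_closed N that by blast
  have cN: "c \<in> N" and wN: "w \<in> N" using closed v0 by (auto simp: c_def w_def)
  have w0: "w \<noteq> 0" using v0 by (simp add: w_def c_def act_mult)
  have P\<sigma>: "act P (act \<sigma> v) = 0" if "v \<in> N" for v using ann[OF that] by (simp add: act_mult)
  have w_eq: "w = act \<sigma> (act \<rho> v0)"
    unfolding w_def c_def by (simp flip: act_mult add: mult.commute)
  \<comment> \<open>If \<open>w\<close> is an eigenvector for \<open>a\<close>, then \<open>D T - T D\<close> is \<open>f((T - a) \<sigma>(T) u) w\<close>, and \<open>f\<close> is chosen not to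
    vanish there; otherwise \<open>T w\<close> is no multiple of \<open>w\<close>, so \<open>f w \<noteq> 0\<close> suffices.\<close>
  obtain f u where f: "Vector_Spaces.linear scale (*) f" and u: "u \<in> N"
    and neq: "scale (f (act \<sigma> (T u))) w \<noteq> scale (f (act \<sigma> u)) (T w)"
  proof (cases "\<exists>a. T w = scale a w")
    case True
    then obtain a where a: "T w = scale a w" by blast
    obtain u where u: "u \<in> N" "act ([:- a, 1:] * \<sigma>) u \<noteq> 0" using nonscalar by blast
    let ?z = "act ([:- a, 1:] * \<sigma>) u"
    have z: "?z = act \<sigma> (T u) - scale a (act \<sigma> u)"
      by (simp only: act_mult) (simp add: act_T T_add T_scale)
    obtain f where f: "Vector_Spaces.linear scale (*) f" "f ?z = 1"
      using functional_exists[OF u(2)] .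
    have "f (act \<sigma> (T u)) = f ?z + a * f (act \<sigma> u)"
      using f(1) z by (metis diff_add_cancel Vector_Spaces.linear_iff)
    then have "f (act \<sigma> (T u)) = 1 + a * f (act \<sigma> u)" using f(2) by simp
    then have "scale (f (act \<sigma> (T u))) w - scale (f (act \<sigma> u)) (T w) = w"
      unfolding a by (simp add: scale_left_distrib mult.commute)
    then show ?thesis using that[OF f(1) u(1)] w0 by (metis right_minus_eq)
  next
    case False
    obtain f where f: "Vector_Spaces.linear scale (*) f" "f w = 1"
      using functional_exists[OF w0] .
    show ?thesis
    proof (rule that[OF f(1)])
      show "act \<rho> v0 \<in> N" using closed v0 by blast
      show "scale (f (act \<sigma> (T (act \<rho> v0)))) w \<noteq> scale (f (act \<sigma> (act \<rho> v0))) (T w)"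
        using False f(2) by (metis w_eq scale_one)
    qed
  qed
  have f_add: "f (u + v) = f u + f v" and f_scale: "f (scale k v) = k * f v" for u v k
    using f by (auto simp: Vector_Spaces.linear_iff)
  define D where "D v = scale (f (act \<sigma> v)) w" for v
  show ?thesis
  proof (rule that[of D])
    show "Vector_Spaces.linear scale scale D"
      by (simp add: Vector_Spaces.linear_iff vector_space_axioms D_def act_add_right act_scale_right f_add f_scale
          scale_left_distrib)
    show "range D \<subseteq> N" using wN N(1) by (auto simp: D_def intro: subspace_scale)
    show "\<exists>u\<in>N. D (T u) \<noteq> T (D u)" using u neq by (auto simp: D_def T_scale)
    show "locally_commuting N D"
      unfolding locally_commuting_def
    proof
      fix u assume u: "u \<in> N"
      show "\<exists>A. Vector_Spaces.linear scale scale A \<and> range A \<subseteq> N \<and>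
        (\<forall>v\<in>N. A (T v) = T (A v)) \<and> D u = A u"
      proof (cases "act \<sigma> u = 0")
        case True
        have "D u = 0" using True f_scale[of 0 0] by (simp add: D_def)
        then show ?thesis
          by (intro exI[of _ "\<lambda>_. 0"]) (auto simp: Vector_Spaces.linear_iff vector_space_axioms N subspace_0)
      next
        case False
        obtain A where A: "Vector_Spaces.linear scale scale A" "A (act \<sigma> u) = act \<rho> c"
          "\<And>v. act P v = 0 \<Longrightarrow> A (T v) = T (A v)" "\<And>v. \<exists>q. A v = act q c"
          using commuting_map_exists[OF soc P\<sigma>[OF u] False P\<sigma>[OF v0(1), folded c_def]] by blast
        let ?A = "\<lambda>v. scale (f (act \<sigma> u)) (A (act \<sigma> v))"
        have "Vector_Spaces.linear scale scale ?A" using A(1)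
          by (simp add: Vector_Spaces.linear_iff act_add_right act_scale_right scale_right_distrib mult.commute)
        moreover have "range ?A \<subseteq> N"
          using A(4) closed[OF cN] subspace_scale[OF N(1)] by (metis image_subsetI)
        moreover have "\<forall>v\<in>N. ?A (T v) = T (?A v)" by (simp add: act_T A(3) P\<sigma> T_scale)
        ultimately show ?thesis using A(2) by (intro exI[of _ ?A]) (simp add: D_def w_def)
      qed
    qed
  qed
qed

section \<open>Diagonalizability and the minimal polynomial\<close>

text \<open>
  The hypotheses say that \<open>p\<close> is a product of distinct linear factors, up to a constant. Splitting off one of them, say
  \<open>p = (t - a) p'\<close>, the vector \<open>p'(T) v\<close> is an eigenvector or zero, and subtracting its multiple by
  \<open>1 / p'(a)\<close> from \<open>v\<close> leaves a vector killed by \<open>p'\<close>.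
\<close>

lemma span_eigenvectors:
  assumes N: "subspace N" "\<And>u. u \<in> N \<Longrightarrow> T u \<in> N"
    and "p \<noteq> 0" "\<And>q. irreducible q \<Longrightarrow> q dvd p \<Longrightarrow> degree q \<le> 1" "\<And>a. \<not> [:- a, 1:]\<^sup>2 dvd p"
    and "v \<in> N" "act p v = 0"
  shows "v \<in> span {u \<in> N. \<exists>a. T u = scale a u}"
  using assms(3-)
proof (induction "degree p" arbitrary: p v)
  case 0
  then obtain a where a: "p = [:a:]" by (metis degree_eq_zeroE)
  then have "v = 0" using 0 by simp
  then show ?case by (simp add: span_zero)
next
  case (Suc n)
  obtain q where q: "irreducible q" "q dvd p"
    using irreducible_factor_exists[of p] Suc.hyps(2) by auto
  have "degree q = 1" using Suc.prems(2)[OF q] q(1)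
    by (metis One_nat_def is_unit_iff_degree irreducible_def le_Suc_eq le_zero_eq)
  then obtain b0 b1 where b: "q = [:b0, b1:]" "b1 \<noteq> 0"
    by (cases q) (auto split: if_splits elim!: degree_eq_zeroE)
  define a where "a = - b0 / b1"
  have "poly q a = 0" using b by (simp add: a_def)
  then have "[:- a, 1:] dvd p" using q(2) by (meson dvd_trans poly_eq_0_iff_dvd)
  then obtain p' where p': "p = [:- a, 1:] * p'" by (auto simp: dvd_def)
  have p'0: "p' \<noteq> 0" using p' Suc.prems(1) by auto
  have "degree p = 1 + degree p'" unfolding p' by (subst degree_mult_eq) (use p'0 in auto)
  then have deg: "n = degree p'" using Suc.hyps(2) by simp
  have k: "poly p' a \<noteq> 0"
  proof
    assume "poly p' a = 0"
    then have "[:- a, 1:] dvd p'" by (simp add: poly_eq_0_iff_dvd)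
    then have "[:- a, 1:]\<^sup>2 dvd p" unfolding p' power2_eq_square by (simp only: mult_dvd_mono dvd_refl)
    then show False using Suc.prems(3) by blast
  qed
  define y where "y = scale (inverse (poly p' a)) (act p' v)"
  have yN: "y \<in> N" unfolding y_def
    using act_closed[OF N Suc.prems(4)] N(1) subspace_scale by blast
  have "act [:- a, 1:] (act p' v) = 0" using Suc.prems(5) unfolding p' act_mult .
  then have "T (act p' v) = scale a (act p' v)" by simp
  then have Ty: "T y = scale a y" unfolding y_def by (simp add: T_scale mult.commute)
  have "act p' y = scale (poly p' a) y" using act_eigenvector[OF Ty] .
  also have "\<dots> = act p' v" using k by (simp add: y_def)
  finally have "act p' (v - y) = 0" by (simp add: act_diff_right)
  moreover have "v - y \<in> N" using yN Suc.prems(4) N(1) subspace_diff by blast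
  moreover have "p' dvd p" unfolding p' by (rule dvd_triv_right)
  ultimately have "v - y \<in> span {u \<in> N. \<exists>a. T u = scale a u}"
    using Suc.hyps(1)[OF deg p'0] Suc.prems(2,3) by (meson dvd_trans)
  moreover have "y \<in> span {u \<in> N. \<exists>a. T u = scale a u}" using yN Ty by (auto intro: span_base)
  ultimately show ?case using span_add[of "v - y" _ y] by simp
qed

text \<open>
  The iterates of \<open>v\<close> cannot all be independent in a finite-dimensional space. One that depends on
  its predecessors gives a monic polynomial.
\<close>

lemma vector_annihilator:
  assumes "finite B" "\<And>i. (T ^^ i) v \<in> span B"
  obtains p where "p \<noteq> 0" "act p v = 0"
proof -
  let ?S = "\<lambda>k. (\<lambda>i. (T ^^ i) v) ` {..<k}"
  have "\<exists>k. (T ^^ k) v \<in> span (?S k)"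
  proof (rule ccontr)
    assume "\<not> ?thesis"
    then have *: "(T ^^ k) v \<notin> span (?S k)" for k by blast
    have "independent (?S k) \<and> card (?S k) = k" for k
    proof (induction k)
      case (Suc k)
      have "(T ^^ k) v \<notin> ?S k" using *[of k] span_base[of "(T ^^ k) v" "?S k"] by argo
      moreover have "?S (Suc k) = insert ((T ^^ k) v) (?S k)" by (simp only: lessThan_Suc image_insert)
      ultimately show ?case using Suc *[of k] independent_insertI[OF *[of k]]
        by (metis card_insert_disjoint finite_imageI finite_lessThan)
    qed (simp add: independent_empty)
    from this[of "Suc (card B)"]
    have S: "independent (?S (Suc (card B)))" "card (?S (Suc (card B))) = Suc (card B)" by blast+
    have "?S (Suc (card B)) \<subseteq> span B" using assms(2) by blast
    from independent_span_bound[OF assms(1) S(1) this] S(2) show False by simp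
  qed
  then obtain k where k: "(T ^^ k) v \<in> span (?S k)" by blast
  have act_monom: "act (monom a i) v = scale a ((T ^^ i) v)" for a i
    by (induction i) (simp_all add: monom_0 monom_Suc T_scale)
  let ?V = "{act q v |q. \<forall>i\<ge>k. coeff q i = 0}"
  have "span (?S k) \<subseteq> ?V"
  proof (rule span_minimal)
    show "?S k \<subseteq> ?V"
    proof clarify
      fix i assume "i < k"
      then show "\<exists>q. (T ^^ i) v = act q v \<and> (\<forall>i\<ge>k. coeff q i = 0)"
        by (intro exI[of _ "monom 1 i"]) (auto simp: act_monom)
    qed
    show "subspace ?V"
    proof (rule subspaceI)
      show "0 \<in> ?V" by (auto intro!: exI[of _ 0])
      show "a + b \<in> ?V" if ab: "a \<in> ?V" "b \<in> ?V" for a b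
      proof -
        obtain q r where "a = act q v" "\<forall>i\<ge>k. coeff q i = 0" "b = act r v" "\<forall>i\<ge>k. coeff r i = 0"
          using ab by blast
        then show ?thesis by (auto simp: act_add intro!: exI[of _ "q + r"])
      qed
      show "scale c a \<in> ?V" if a: "a \<in> ?V" for c a
      proof -
        obtain q where "a = act q v" "\<forall>i\<ge>k. coeff q i = 0" using a by blast
        then show ?thesis by (auto simp: act_smult intro!: exI[of _ "smult c q"])
      qed
    qed
  qed
  then obtain q where q: "(T ^^ k) v = act q v" "\<forall>i\<ge>k. coeff q i = 0" using k by blast
  show ?thesis
  proof (rule that[of "monom 1 k - q"])
    show "monom 1 k - q \<noteq> 0" using q(2) by (metis coeff_diff coeff_monom diff_zero coeff_0 order_refl zero_neq_one)
    show "act (monom 1 k - q) v = 0" using q(1) by (simp add: act_diff act_monom)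
  qed
qed

lemma subspace_annihilator:
  assumes "finite B" "\<And>u. u \<in> span B \<Longrightarrow> T u \<in> span B"
  obtains p where "p \<noteq> 0" "\<And>v. v \<in> span B \<Longrightarrow> act p v = 0"
proof -
  have ex: "\<exists>p. p \<noteq> 0 \<and> (\<forall>b\<in>C. act p b = 0)" if "finite C" "C \<subseteq> B" for C
    using that
  proof (induction C rule: finite_induct)
    case empty
    then show ?case by (intro exI[of _ 1]) simp
  next
    case (insert b C)
    then obtain p where p: "p \<noteq> 0" "\<forall>b\<in>C. act p b = 0" by auto
    have "(T ^^ i) b \<in> span B" for i
      by (induction i) (use insert assms(2) in \<open>auto intro: span_base\<close>)
    then obtain q where q: "q \<noteq> 0" "act q b = 0" using vector_annihilator[OF assms(1)] by blast
    have "act (q * p) u = 0" if "u \<in> insert b C" for u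
      using that p(2) q(2) by (auto simp: act_mult) (metis act_mult act_0_right mult.commute)
    then show ?case using p(1) q(1) by (intro exI[of _ "q * p"]) auto
  qed
  obtain p where p: "p \<noteq> 0" "\<forall>b\<in>B. act p b = 0" using ex[OF assms(1)] by auto
  have "act p v = 0" if "v \<in> span B" for v
    using that by (induction rule: span_induct_alt) (use p in \<open>auto simp: act_add_right act_scale_right\<close>)
  then show ?thesis using that p(1) by blast
qed

text \<open>
  Everything is decided by the minimal polynomial \<open>\<mu>\<close> of \<open>T\<close> on \<open>N\<close>, obtained as a nonzero annihilator
  of least degree. If it is a product of distinct linear factors, eigenvectors span \<open>N\<close>. Otherwise it is
  divisible by some \<open>P\<close> of degree at least two with a socle generator.
\<close>

lemma diagonalizable_or_locally_commuting:
  assumes "finite B" and N: "N = span B" "\<And>u. u \<in> N \<Longrightarrow> T u \<in> N"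
  shows "(\<exists>E. independent E \<and> span E = N \<and> (\<forall>b\<in>E. \<exists>a. T b = scale a b)) \<or>
    (\<exists>D. Vector_Spaces.linear scale scale D \<and> range D \<subseteq> N \<and>
       locally_commuting N D \<and> (\<exists>u\<in>N. D (T u) \<noteq> T (D u)))"
proof -
  have sub: "subspace N" using N by simp
  define Ann where "Ann p \<longleftrightarrow> p \<noteq> 0 \<and> (\<forall>v\<in>N. act p v = 0)" for p
  have "\<exists>p. Ann p" using subspace_annihilator[OF assms(1)] N unfolding Ann_def by metis
  then obtain \<mu> where \<mu>: "Ann \<mu>" and min: "\<And>p. Ann p \<Longrightarrow> degree \<mu> \<le> degree p"
    by (metis ex_has_least_nat)
  have \<mu>0: "\<mu> \<noteq> 0" using \<mu> by (simp add: Ann_def)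
  have right: ?thesis if P: "P dvd \<mu>" "socle_generator P \<rho>" "degree P \<ge> 2" for P \<rho>
  proof -
    obtain \<sigma> where \<sigma>: "\<mu> = P * \<sigma>" using P by (auto simp: dvd_def)
    have nz: "P \<noteq> 0" "\<sigma> \<noteq> 0" using \<sigma> \<mu>0 by auto
    \<comment> \<open>Minimality of \<open>\<mu>\<close>, used for \<open>p = \<rho>\<close> and, because \<open>P\<close> has degree at least two, for linear \<open>p\<close>.\<close>
    have ex: "\<exists>v\<in>N. act (p * \<sigma>) v \<noteq> 0" if p: "p \<noteq> 0" "degree p < degree P" for p
    proof (rule ccontr)
      assume "\<not> ?thesis"
      then have "Ann (p * \<sigma>)" using p nz by (auto simp: Ann_def)
      from min[OF this] show False using p nz by (simp add: \<sigma> degree_mult_eq)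
    qed
    have "\<exists>v\<in>N. act (\<rho> * \<sigma>) v \<noteq> 0" using P(2) by (intro ex) (auto simp: socle_generator_def)
    moreover have "\<exists>v\<in>N. act ([:- a, 1:] * \<sigma>) v \<noteq> 0" for a using P(3) by (intro ex) auto
    moreover have "act (P * \<sigma>) v = 0" if "v \<in> N" for v using \<mu> that by (simp add: Ann_def \<sigma>)
    ultimately obtain D where "Vector_Spaces.linear scale scale D" "range D \<subseteq> N"
      "locally_commuting N D" "\<exists>u\<in>N. D (T u) \<noteq> T (D u)"
      using locally_commuting_not_commuting[OF sub N(2) P(2)] by blast
    then show ?thesis by blast
  qed
  show ?thesis
  proof (cases "(\<exists>q. irreducible q \<and> q dvd \<mu> \<and> degree q \<ge> 2) \<or> (\<exists>a. [:- a, 1:]\<^sup>2 dvd \<mu>)")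
    case True
    then show ?thesis
    proof (elim disjE exE conjE)
      fix q assume "irreducible q" "q dvd \<mu>" "degree q \<ge> 2"
      then show ?thesis using right socle_generator_irreducible by blast
    next
      fix a assume "[:- a, 1:]\<^sup>2 dvd \<mu>"
      then show ?thesis using right[OF _ socle_generator_square] by (simp add: degree_power_eq)
    qed
  next
    case False
    let ?E = "{u \<in> N. \<exists>a. T u = scale a u}"
    have "v \<in> span ?E" if "v \<in> N" for v
    proof (rule span_eigenvectors[OF sub N(2) \<mu>0])
      show "degree q \<le> 1" if "irreducible q" "q dvd \<mu>" for q
        using False that by (metis One_nat_def not_less_eq_eq numeral_2_eq_2)
      show "\<not> [:- a, 1:]\<^sup>2 dvd \<mu>" for a using False by blast
      show "act \<mu> v = 0" using \<mu> \<open>v \<in> N\<close> by (simp add: Ann_def)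
    qed (use that in auto)
    moreover have "span ?E \<subseteq> N" using sub by (intro span_minimal) auto
    ultimately have spE: "span ?E = N" by blast
    obtain E where E: "E \<subseteq> ?E" "independent E" "?E \<subseteq> span E"
      using maximal_independent_subset[of ?E] by blast
    have "span E = N"
    proof
      show "span E \<subseteq> N" using span_mono[OF E(1)] spE by simp
      show "N \<subseteq> span E" using span_minimal[OF E(3)] spE by simp
    qed
    then show ?thesis using E by blast
  qed
qed

end


section \<open>Derivations of an extension of an abelian ideal by one element\<close>

text \<open>
  The decomposition \<open>L = N + k x\<close> is encoded by the coordinate functional \<open>\<xi>\<close> along \<open>x\<close>; the projection onto
  \<open>N\<close> is then \<open>v \<mapsto> v - \<xi>(v) x\<close>.
\<close>

locale abelian_ideal_of_codimension_one = lie_algebra scale bracket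
  for scale :: "'k::field \<Rightarrow> 'v::ab_group_add \<Rightarrow> 'v" and bracket :: "'v \<Rightarrow> 'v \<Rightarrow> 'v" +
  fixes N :: "'v set" and x :: 'v and \<xi> :: "'v \<Rightarrow> 'k"
  assumes ideal_N: "lie_ideal N"
    and abelian_N: "abelian N"
    and linear_\<xi>: "Vector_Spaces.linear scale (*) \<xi>"
    and \<xi>_x [simp]: "\<xi> x = 1"
    and \<xi>_eq_0_iff: "\<xi> v = 0 \<longleftrightarrow> v \<in> N"
begin

sublocale operator_action scale "ad x"
  using linear_left[of x] vector_space_axioms
  by (simp add: operator_action_def operator_action_axioms_def ad_def[abs_def])

lemma subspace_N: "subspace N" using ideal_N by (simp add: lie_ideal_def)

lemma bracket_in_N: "u \<in> N \<Longrightarrow> bracket u v \<in> N" using ideal_N by (simp add: lie_ideal_def)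

lemma ad_in_N: "u \<in> N \<Longrightarrow> ad x u \<in> N" by (simp add: ad_def bracket_in_N)

lemma \<xi>_add [simp]: "\<xi> (u + v) = \<xi> u + \<xi> v"
  and \<xi>_scale [simp]: "\<xi> (scale c v) = c * \<xi> v"
  using linear_\<xi> by (auto simp: Vector_Spaces.linear_iff)

lemma \<xi>_diff [simp]: "\<xi> (u - v) = \<xi> u - \<xi> v"
  using \<xi>_add[of "u - v" v] by (simp del: \<xi>_add)

lemma bracket_add: "bracket (u + u') v = bracket u v + bracket u' v"
    "bracket u (v + v') = bracket u v + bracket u v'"
  and bracket_scale: "bracket (scale c u) v = scale c (bracket u v)"
    "bracket u (scale c v) = scale c (bracket u v)"
  using linear_left[of v] linear_right[of u] by (auto simp: Vector_Spaces.linear_iff)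

lemma bracket_swap: "bracket u v = - bracket v u"
proof -
  have "bracket (u + v) (u + v) = bracket u v + bracket v u"
    by (simp only: bracket_add alternating[of u] alternating[of v] add_0_left add_0_right add.commute)
  then show ?thesis using alternating[of "u + v"] by (metis eq_neg_iff_add_eq_0)
qed

lemma decompose: obtains z where "z \<in> N" "v = z + scale (\<xi> v) x"
proof (rule that[of "v - scale (\<xi> v) x"])
  show "v - scale (\<xi> v) x \<in> N" by (simp flip: \<xi>_eq_0_iff)
qed simp

lemma ad_self: "ad x x = 0" by (simp add: ad_def alternating)

text \<open>
  Everything about the bracket is contained in \<open>ad x\<close>: on \<open>N\<close> the bracket vanishes, and \<open>ad x\<close> kills \<open>x\<close>.
\<close>

lemma bracket_eq: "bracket u v = scale (\<xi> v) (ad x u) - scale (\<xi> u) (ad x v)"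
proof -
  obtain y z where y: "y \<in> N" "u = y + scale (\<xi> u) x" and z: "z \<in> N" "v = z + scale (\<xi> v) x"
    using decompose by metis
  have "bracket y z = 0" using abelian_N y z by (simp add: abelian_def)
  then have "bracket (y + scale a x) (z + scale b x) = scale b (ad x y) - scale a (ad x z)" for a b
    using bracket_swap[of x z] by (simp add: bracket_add bracket_scale alternating ad_def)
  moreover have "ad x (y + scale a x) = ad x y" "ad x (z + scale a x) = ad x z" for a
    by (simp_all add: T_add T_scale ad_self)
  ultimately show ?thesis using y(2) z(2) by metis
qed

text \<open>
  The value \<open>D x\<close> is an arbitrary element of \<open>N\<close>: by antisymmetry its two contributions to the Leibniz
  rule cancel.
\<close>

lemma derivation_if_commutes:
  assumes D: "Vector_Spaces.linear scale scale D" and range: "range D \<subseteq> N"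
    and comm: "\<And>v. v \<in> N \<Longrightarrow> D (ad x v) = ad x (D v)"
  shows "derivation D"
  unfolding derivation_def
proof (intro conjI allI)
  have D_add: "D (u + v) = D u + D v" and D_scale: "D (scale c v) = scale c (D v)" for u v c
    using D by (auto simp: Vector_Spaces.linear_iff)
  have D_diff: "D (u - v) = D u - D v" for u v
    using D_add[of "u - v" v] by simp
  have \<xi>D: "\<xi> (D v) = 0" for v using range \<xi>_eq_0_iff by blast
  have comm': "D (ad x v) = ad x (D v) - scale (\<xi> v) (ad x (D x))" for v
  proof -
    obtain z where z: "z \<in> N" "v = z + scale (\<xi> v) x" using decompose by metis
    have "D (ad x (z + scale a x)) = ad x (D (z + scale a x)) - scale a (ad x (D x))" for a
      using comm[OF z(1)] by (simp add: T_add T_scale ad_self D_add D_scale)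
    then show ?thesis using z(2) by metis
  qed
  show "D (bracket u v) = bracket (D u) v + bracket u (D v)" for u v
    by (simp add: bracket_eq \<xi>D D_diff D_scale comm' scale_right_diff_distrib mult.commute)
qed (rule D)

text \<open>
  Let \<open>b\<close> be an eigenvector with eigenvalue \<open>c \<noteq> 0\<close>. Applying \<open>d\<close> to \<open>[b, x] = c b\<close> and taking the coordinate along
  \<open>x\<close> shows that \<open>d b\<close> lies in \<open>N\<close>; applying \<open>d\<close> to \<open>[v, b] = 0\<close> then shows the same for \<open>d v\<close> with \<open>v\<close> in \<open>N\<close>. Finally the
  \<open>b\<close>-coordinates in \<open>d [b, x] = [d b, x] + [b, d x]\<close> show that \<open>d x\<close> lies in \<open>N\<close>, since \<open>ad x\<close> multiplies
  the \<open>b\<close>-coordinate of every vector of \<open>N\<close> by \<open>c\<close>.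
\<close>

lemma derivation_commutes:
  assumes E: "independent E" "span E = N" "\<forall>b\<in>E. \<exists>c. ad x b = scale c b"
    and nz: "\<exists>v\<in>N. ad x v \<noteq> 0" and d: "derivation d"
  shows "range d \<subseteq> N" and "v \<in> N \<Longrightarrow> d (ad x v) = ad x (d v)"
proof -
  have d_add: "d (u + v) = d u + d v" and d_scale: "d (scale c v) = scale c (d v)"
    and d_bracket: "d (bracket u v) = bracket (d u) v + bracket u (d v)" for u v c
    using d by (auto simp: derivation_def Vector_Spaces.linear_iff)
  obtain b c where b: "b \<in> E" "ad x b = scale c b" and c: "c \<noteq> 0"
  proof -
    have "\<exists>b\<in>E. ad x b \<noteq> 0"
    proof (rule ccontr)
      assume *: "\<not> ?thesis"
      have "ad x v = 0" if "v \<in> span E" for v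
        using that by (induction rule: span_induct_alt) (use * in \<open>auto simp: T_add T_scale\<close>)
      then show False using nz E(2) by blast
    qed
    then show ?thesis using E(3) that by (metis scale_zero_left)
  qed
  have bN: "b \<in> N" using b E(2) span_base by blast
  have \<xi>N: "\<xi> v = 0" if "v \<in> N" for v using that \<xi>_eq_0_iff by simp
  have b0: "b \<noteq> 0" using b(1) E(1) dependent_zero by blast
  have d_ad: "d (ad x v) = ad x (d v) + scale (\<xi> (d x)) (ad x v)" if "v \<in> N" for v
    using d_bracket[of v x] bracket_eq[of v "d x"] \<xi>N[OF that] by (simp add: ad_def)
  have "c * \<xi> (d b) = \<xi> (d (ad x b))" by (simp add: b(2) d_scale)
  also have "\<dots> = \<xi> (ad x (d b))" by (simp add: d_ad[OF bN] \<xi>N[OF ad_in_N[OF bN]])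
  also have "\<dots> = 0"
  proof -
    obtain z where z: "z \<in> N" "d b = z + scale (\<xi> (d b)) x" using decompose by metis
    have "ad x (z + scale a x) = ad x z" for a by (simp add: T_add T_scale ad_self)
    then show ?thesis using z \<xi>N[OF ad_in_N[OF z(1)]] by metis
  qed
  finally have db: "\<xi> (d b) = 0" using c by simp
  have dN: "d v \<in> N" if "v \<in> N" for v
  proof -
    have "bracket v b = 0" using abelian_N that bN by (simp add: abelian_def)
    then have "0 = bracket (d v) b + bracket v (d b)"
      using d_bracket[of v b] d_scale[of 0 0] by simp
    also have "\<dots> = - scale (\<xi> (d v) * c) b"
      using db \<xi>N[OF that] \<xi>N[OF bN] by (simp add: bracket_eq b(2))
    finally show ?thesis using c b0 by (simp flip: \<xi>_eq_0_iff)
  qed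
  let ?r = "\<lambda>v. representation E v b"
  have "?r (ad x v) = c * ?r v \<and> v \<in> N" if "v \<in> span E" for v
    using that
  proof (induction rule: span_induct_alt)
    case base
    then show ?case by (simp add: representation_zero subspace_0[OF subspace_N])
  next
    case (step a e v)
    obtain k where k: "ad x e = scale k e" using E(3) step(1) by blast
    have e: "e \<in> span E" using step(1) span_base by blast
    have v: "v \<in> span E" "ad x v \<in> span E" using step(2) ad_in_N E(2) by auto
    have "?r (ad x (scale a e + v)) = a * (k * ?r e) + c * ?r v"
      using step(2) e v E(1) by (simp add: T_add T_scale k representation_add representation_scale span_scale)
    moreover have "k * ?r e = c * ?r e"
      using k b step(1) b0 scale_cancel_right by (auto simp: representation_basis[OF E(1)])
    ultimately have "?r (ad x (scale a e + v)) = c * ?r (scale a e + v)" using e v E(1)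
      by (simp add: representation_add representation_scale span_scale algebra_simps)
    moreover have "scale a e + v \<in> N" using e v E(2) span_add span_scale by blast
    ultimately show ?case by blast
  qed
  then have rep_ad: "?r (ad x v) = c * ?r v" if "v \<in> span E" for v using that by blast
  have dx: "\<xi> (d x) = 0"
  proof -
    have N': "d b \<in> span E" "ad x (d b) \<in> span E" "b \<in> span E" using dN[OF bN] ad_in_N bN E(2) by auto
    have "scale c (d b) = ad x (d b) + scale (\<xi> (d x) * c) b"
      using d_ad[OF bN] by (simp add: b(2) d_scale)
    then have "?r (scale c (d b)) = ?r (ad x (d b) + scale (\<xi> (d x) * c) b)" by simp
    then have "c * ?r (d b) = c * ?r (d b) + \<xi> (d x) * c * ?r b"
      using N' E(1) by (simp add: representation_add representation_scale span_scale rep_ad)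
    then show ?thesis using c b(1) E(1) by (simp add: representation_basis)
  qed
  show "range d \<subseteq> N"
  proof clarify
    fix v
    obtain z where z: "z \<in> N" "v = z + scale (\<xi> v) x" using decompose by metis
    have "\<xi> (d (z + scale a x)) = 0" for a using \<xi>N[OF dN[OF z(1)]] dx by (simp add: d_add d_scale)
    then show "d v \<in> N" using z(2) \<xi>_eq_0_iff by metis
  qed
  show "d (ad x v) = ad x (d v)" if "v \<in> N" using d_ad[OF that] dx by simp
qed

text \<open>
  Commutation with \<open>ad x\<close> needs to be tested only on the eigenbasis, and there it follows at one vector at a
  time because \<open>ad x\<close> maps a basis vector to a multiple of itself.
\<close>

lemma local_derivation_is_derivation:
  assumes E: "independent E" "span E = N" "\<forall>b\<in>E. \<exists>c. ad x b = scale c b"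
    and nz: "\<exists>v\<in>N. ad x v \<noteq> 0" and \<Delta>: "local_derivation \<Delta>"
  shows "derivation \<Delta>"
proof (rule derivation_if_commutes)
  note commutes = derivation_commutes[OF E nz]
  have loc: "\<exists>d. derivation d \<and> \<Delta> u = d u" for u using \<Delta> by (auto simp: local_derivation_def)
  show lin: "Vector_Spaces.linear scale scale \<Delta>" using \<Delta> by (simp add: local_derivation_def)
  have \<Delta>_add: "\<Delta> (u + v) = \<Delta> u + \<Delta> v" and \<Delta>_scale: "\<Delta> (scale c v) = scale c (\<Delta> v)" for u v c
    using lin by (auto simp: Vector_Spaces.linear_iff)
  show "range \<Delta> \<subseteq> N" using commutes(1) loc by (metis image_subset_iff rangeI)
  have on_E: "\<Delta> (ad x b) = ad x (\<Delta> b)" if bE: "b \<in> E" for b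
  proof -
    obtain c where c: "ad x b = scale c b" using E(3) bE by blast
    obtain d where d: "derivation d" "\<Delta> b = d b" using loc by blast
    have "b \<in> N" using bE E(2) span_base by blast
    then have "ad x (d b) = d (scale c b)" using commutes(2)[OF d(1)] c by metis
    also have "\<dots> = scale c (d b)" using d(1) by (simp add: derivation_def Vector_Spaces.linear_iff)
    finally show ?thesis using c d(2) \<Delta>_scale by simp
  qed
  have \<Delta>0: "\<Delta> 0 = 0" using \<Delta>_scale[of 0 0] by simp
  have "\<Delta> (ad x v) = ad x (\<Delta> v)" if "v \<in> span E" for v
    using that
    by (induction rule: span_induct_alt) (simp_all add: on_E \<Delta>0 T_add T_scale \<Delta>_add \<Delta>_scale)
  then show "\<Delta> (ad x v) = ad x (\<Delta> v)" if "v \<in> N" for v using that E(2) by blast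
qed

text \<open>
  At a vector of \<open>N\<close> the local commutation of \<open>D\<close> provides the derivation. At any other vector \<open>u\<close> the
  derivation can vanish on \<open>N\<close> and take at \<open>x\<close> the value in \<open>N\<close> that produces the prescribed image of \<open>u\<close>.
\<close>

lemma locally_commuting_local_derivation:
  assumes D: "Vector_Spaces.linear scale scale D" "range D \<subseteq> N" and loc: "locally_commuting N D"
  shows "local_derivation (\<lambda>v. D (v - scale (\<xi> v) x))"
proof -
  let ?p = "\<lambda>v. v - scale (\<xi> v) x"
  have p_add: "?p (u + v) = ?p u + ?p v" for u v by (simp add: scale_left_distrib)
  have p_scale: "?p (scale c v) = scale c (?p v)" for c v by (simp add: scale_right_diff_distrib)
  have pN: "?p v \<in> N" for v by (simp flip: \<xi>_eq_0_iff)
  have p_id: "?p v = v" if "v \<in> N" for v using that by (simp flip: \<xi>_eq_0_iff)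
  have lin_p: "Vector_Spaces.linear scale scale (\<lambda>v. A (?p v))"
    if "Vector_Spaces.linear scale scale A" for A
    using that unfolding Vector_Spaces.linear_iff by (simp only: p_add p_scale) blast
  have DN: "D v \<in> N" for v using D(2) by blast
  show ?thesis
    unfolding local_derivation_def
  proof (intro conjI allI)
    show "Vector_Spaces.linear scale scale (\<lambda>v. D (?p v))" by (rule lin_p) (rule D(1))
    fix u
    show "\<exists>d. derivation d \<and> D (?p u) = d u"
    proof (cases "u \<in> N")
      case True
      then obtain A where A: "Vector_Spaces.linear scale scale A" "range A \<subseteq> N"
        "\<forall>v\<in>N. A (ad x v) = ad x (A v)" "D u = A u"
        using loc unfolding locally_commuting_def by blast
      have "derivation (\<lambda>v. A (?p v))"
      proof (rule derivation_if_commutes)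
        show "Vector_Spaces.linear scale scale (\<lambda>v. A (?p v))" by (rule lin_p) (rule A(1))
        show "range (\<lambda>v. A (?p v)) \<subseteq> N" using A(2) by blast
        show "A (?p (ad x v)) = ad x (A (?p v))" if "v \<in> N" for v
          using A(3) that by (simp only: p_id ad_in_N)
      qed
      moreover have "D (?p u) = A (?p u)" using A(4) p_id[OF True] by metis
      ultimately show ?thesis by blast
    next
      case False
      then have nz: "\<xi> u \<noteq> 0" by (simp add: \<xi>_eq_0_iff)
      let ?d = "\<lambda>v. scale (\<xi> v / \<xi> u) (D (?p u))"
      have "derivation ?d"
      proof (rule derivation_if_commutes)
        show "Vector_Spaces.linear scale scale ?d"
          by (simp add: Vector_Spaces.linear_iff vector_space_axioms scale_left_distrib add_divide_distrib)
        show "range ?d \<subseteq> N" using DN subspace_scale[OF subspace_N] by blast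
        show "?d (ad x v) = ad x (?d v)" if "v \<in> N" for v
        proof -
          have "\<xi> v = 0" "\<xi> (ad x v) = 0" using that ad_in_N by (simp_all add: \<xi>_eq_0_iff)
          then show ?thesis by simp
        qed
      qed
      then show ?thesis using nz by (intro exI[of _ ?d]) simp
    qed
  qed
qed

lemma noncommuting_not_derivation:
  assumes D: "Vector_Spaces.linear scale scale D" and u: "u \<in> N" "D (ad x u) \<noteq> ad x (D u)"
  shows "\<not> derivation (\<lambda>v. D (v - scale (\<xi> v) x))"
proof
  let ?F = "\<lambda>v. D (v - scale (\<xi> v) x)"
  have D0: "D 0 = 0" using D by (metis Vector_Spaces.linear_iff scale_zero_left)
  assume "derivation ?F"
  then have "?F (bracket u x) = bracket (?F u) x + bracket u (?F x)"
    unfolding derivation_def by blast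
  moreover have "\<xi> u = 0" "\<xi> (bracket u x) = 0" using u bracket_in_N by (simp_all add: \<xi>_eq_0_iff)
  moreover have "bracket u 0 = 0" using bracket_scale(2)[of u 0 0] by simp
  ultimately have "D (bracket u x) = bracket (D u) x" by (simp add: D0)
  then show False using u(2) by (simp add: ad_def)
qed

end

section \<open>Local derivations and diagonalizability\<close>

theorem theorem3p2:
  fixes scale :: "'k::field \<Rightarrow> 'v::ab_group_add \<Rightarrow> 'v"
    and bracket :: "'v \<Rightarrow> 'v \<Rightarrow> 'v"
    and N B :: "'v set" and x :: 'v and n :: nat
  assumes lie: "lie_algebra scale bracket"
    and solvable: "lie_algebra.solvable scale bracket UNIV"
    and nilradical: "lie_algebra.is_nilradical scale bracket N"
    and abelian: "lie_algebra.abelian bracket N"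
    and dim_N: "vector_space.dim scale N = n"
    and dim_L: "vector_space.dim scale (UNIV :: 'v set) = n + 1"
    and basis_N: "lie_algebra.basis_of scale B N"
    and basis_L: "lie_algebra.basis_of scale (insert x B) UNIV"
  shows "(\<forall>\<Delta>. lie_algebra.local_derivation scale bracket \<Delta> \<longrightarrow>
             lie_algebra.derivation scale bracket \<Delta>) \<longleftrightarrow>
         lie_algebra.diagonalizable_on scale N (lie_algebra.ad bracket x)"
proof -
  interpret L: lie_algebra scale bracket by (rule lie)
  have N: "L.lie_ideal N" "L.maximal_nilpotent_ideal N"
    using nilradical by (simp_all add: L.is_nilradical_def L.maximal_nilpotent_ideal_def)
  have B: "L.independent B" "L.span B = N" "L.independent (insert x B)" "L.span (insert x B) = UNIV"
    using basis_N basis_L by (simp_all add: L.basis_of_def)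
  have "N \<noteq> UNIV" using dim_N dim_L by auto
  then have xB: "x \<notin> B" using B by (metis insert_absorb)
  have "card (insert x B) = n + 1"
    using L.dim_span_eq_card_independent[OF B(3)] B(4) dim_L by simp
  then have "finite B" by (metis add_is_0 card.infinite finite_insert zero_neq_one)
  let ?\<xi> = "\<lambda>v. L.representation (insert x B) v x"
  interpret C: abelian_ideal_of_codimension_one scale bracket N x ?\<xi>
  proof (intro abelian_ideal_of_codimension_one.intro
      abelian_ideal_of_codimension_one_axioms.intro)
    show "lie_algebra scale bracket" by (rule lie)
    show "L.lie_ideal N" by (rule N)
    show "L.abelian N" by (rule abelian)
    show lin: "Vector_Spaces.linear scale (*) ?\<xi>" using L.linear_representation[OF B(3,4)] .
    show x1: "?\<xi> x = 1" using B(3) by (simp add: L.representation_basis)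
    show "?\<xi> v = 0 \<longleftrightarrow> v \<in> N" for v
    proof
      obtain a where a: "v - scale a x \<in> N"
        using B(2,4) L.span_breakdown_eq[of v x B] by auto
      have N0: "?\<xi> u = 0" if "u \<in> N" for u
      proof -
        have "L.representation (insert x B) u = L.representation B u"
          using that B by (intro L.representation_extend) auto
        then show ?thesis using xB L.representation_ne_zero by metis
      qed
      then show "?\<xi> v = 0" if "v \<in> N" using that by blast
      assume "?\<xi> v = 0"
      moreover have "?\<xi> v = ?\<xi> (v - scale a x) + ?\<xi> (scale a x)"
        using L.representation_add[OF B(3), of "v - scale a x" "scale a x"] B(4) by simp
      moreover have "?\<xi> (scale a x) = a * ?\<xi> x"
        using L.representation_scale[OF B(3), of x a] B(4) by simp
      ultimately have "a = 0" using N0[OF a] x1 by simp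
      then show "v \<in> N" using a by simp
    qed
  qed
  \<comment> \<open>If \<open>ad x\<close> vanished on \<open>N\<close>, the whole algebra would be abelian, hence a nilpotent ideal above \<open>N\<close>.\<close>
  have nz: "\<exists>v\<in>N. L.ad x v \<noteq> 0"
  proof (rule ccontr)
    assume *: "\<not> ?thesis"
    have "L.ad x v = 0" for v
    proof -
      obtain z where "z \<in> N" "v = z + scale (?\<xi> v) x" using C.decompose by metis
      then show ?thesis using * C.T_add C.T_scale C.ad_self by (metis L.scale_zero_right add_0)
    qed
    then have "bracket u v = 0" for u v by (simp add: C.bracket_eq[of u v])
    then have "L.lower_central_series UNIV 1 = {0}" "L.lie_ideal UNIV"
      by (auto simp: L.bracket_space_def L.lie_ideal_def)
    then have "L.lie_ideal UNIV \<and> L.nilpotent UNIV" unfolding L.nilpotent_def by blast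
    then show False using N(2) \<open>N \<noteq> UNIV\<close> by (auto simp: L.maximal_nilpotent_ideal_def)
  qed
  show ?thesis
  proof
    assume "L.diagonalizable_on N (L.ad x)"
    then obtain E where "L.independent E" "L.span E = N" "\<forall>b\<in>E. \<exists>c. L.ad x b = scale c b"
      by (auto simp: L.diagonalizable_on_def L.basis_of_def)
    then show "\<forall>\<Delta>. L.local_derivation \<Delta> \<longrightarrow> L.derivation \<Delta>"
      using C.local_derivation_is_derivation nz by blast
  next
    assume loc: "\<forall>\<Delta>. L.local_derivation \<Delta> \<longrightarrow> L.derivation \<Delta>"
    consider E where "L.independent E" "L.span E = N" "\<forall>b\<in>E. \<exists>a. L.ad x b = scale a b"
      | D u where "Vector_Spaces.linear scale scale D" "range D \<subseteq> N"
          "C.locally_commuting N D" "u \<in> N" "D (L.ad x u) \<noteq> L.ad x (D u)"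
      using C.diagonalizable_or_locally_commuting[of B N] \<open>finite B\<close> B(2) C.ad_in_N by blast
    then show "L.diagonalizable_on N (L.ad x)"
    proof cases
      case (1 E)
      then show ?thesis by (auto simp: L.diagonalizable_on_def L.basis_of_def)
    next
      case (2 D u)
      then show ?thesis
        using loc C.locally_commuting_local_derivation C.noncommuting_not_derivation by blast
    qed
  qed
qed

end
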